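(* Let $G$ be a finite simple graph and let $e$ be an edge of $G$. Then $$b_{id}(G)\leq b_{id}(G-e)+1,$$ where $G-e$ is the graph obtained from $G$ by deleting the edge $e$ (keeping all vertices).
   Context: All graphs are finite and simple. An independent dominating set of a graph $G$ is a set $S\subseteq V(G)$ of pairwise non-adjacent vertices such that every vertex not in $S$ is adjacent to some vertex of $S$. The independent domination number $\gamma_i(G)$ is the minimum size of an independent dominating set of $G$. The independent domination bondage number of $G$ is $b_{id}(G)=\min\{|E'| : E'\subseteq E(G),\ \gamma_i(G-E')\neq\gamma_i(G)\}$, where $G-E'$ is obtained from $G$ by deleting the edges in $E'$ (keeping all vertices). *)

theory Defs
  imports Main "HOL-Library.Extended_Nat"
begin

text \<open>An undirected graph is given by its vertex set and its set of edges, each edge being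
  the two-element set of its endpoints.\<close>

definition finite_simple_graph :: "'a set \<Rightarrow> 'a set set \<Rightarrow> bool" where
  "finite_simple_graph V E \<longleftrightarrow> finite V \<and> (\<forall>e\<in>E. e \<subseteq> V \<and> card e = 2)"

definition independent_dominating_set :: "'a set \<Rightarrow> 'a set set \<Rightarrow> 'a set \<Rightarrow> bool" where
  "independent_dominating_set V E S \<longleftrightarrow>
     S \<subseteq> V \<and>
     (\<forall>u\<in>S. \<forall>v\<in>S. {u, v} \<notin> E) \<and>
     (\<forall>v\<in>V - S. \<exists>u\<in>S. {u, v} \<in> E)"

definition independent_domination_number :: "'a set \<Rightarrow> 'a set set \<Rightarrow> nat" where
  "independent_domination_number V E =
     Min {card S | S. independent_dominating_set V E S}"

text \<open>The infimum in \<^typ>\<open>enat\<close> is a minimum whenever some admissible edge set exists. For an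
  edgeless graph there is none, and the bondage number is then \<open>\<infinity>\<close>.\<close>

definition independent_domination_bondage_number :: "'a set \<Rightarrow> 'a set set \<Rightarrow> enat" where
  "independent_domination_bondage_number V E =
     Inf {enat (card E') | E'. E' \<subseteq> E \<and>
       independent_domination_number V (E - E') \<noteq> independent_domination_number V E}"

text \<open>The minimum defining the independent domination number is taken over a finite nonempty set.\<close>

lemma independent_dominating_set_exists:
  assumes "finite_simple_graph V E"
  shows "\<exists>S. independent_dominating_set V E S"
proof -
  let ?I = "{S. S \<subseteq> V \<and> (\<forall>u\<in>S. \<forall>v\<in>S. {u, v} \<notin> E)}"
  have "finite V" and card2: "\<And>e. e \<in> E \<Longrightarrow> card e = 2"
    using assms by (auto simp: finite_simple_graph_def)
  have loop: "{v} \<notin> E" for v using card2[of "{v}"] by auto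
  have "finite ?I" using \<open>finite V\<close> by simp
  moreover have "{} \<in> ?I" by simp
  ultimately obtain S where S: "S \<in> ?I" and max: "\<And>T. T \<in> ?I \<Longrightarrow> S \<subseteq> T \<Longrightarrow> S = T"
    using finite_has_maximal[of ?I] by (metis (no_types, lifting) empty_iff)
  have "\<exists>u\<in>S. {u, v} \<in> E" if v: "v \<in> V - S" for v
  proof (rule ccontr)
    assume "\<not> (\<exists>u\<in>S. {u, v} \<in> E)"
    then have "insert v S \<in> ?I" using S v loop by (auto simp: insert_commute)
    then show False using max[of "insert v S"] v by auto
  qed
  with S show ?thesis by (auto simp: independent_dominating_set_def)
qed

lemma finite_independent_dominating_set_cards:
  assumes "finite_simple_graph V E"
  shows "finite {card S | S. independent_dominating_set V E S}"
proof -
  have "{card S | S. independent_dominating_set V E S} \<subseteq> card ` Pow V"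
    by (auto simp: independent_dominating_set_def)
  then show ?thesis
    using assms by (rule_tac finite_subset) (auto simp: finite_simple_graph_def)
qed

end

theory Submission
  imports Defs
begin

text \<open>Either deleting \<open>e\<close> alone changes the independent domination number, and then the bondage
  number of \<open>G\<close> is at most \<open>1\<close>, or \<open>G\<close> and \<open>G - e\<close> have the same independent domination number.
  In the second case, an optimal edge set \<open>F\<close> for \<open>G - e\<close> yields \<open>F \<union> {e}\<close> as a witness for \<open>G\<close>:
  deleting it from \<open>G\<close> leaves the graph \<open>(G - e) - F\<close>, whose independent domination number differs
  from the common value. If no edge set changes the number for \<open>G - e\<close>, its bondage number is
  \<open>\<infinity>\<close> and the bound is trivial.\<close>

lemma bondage_number_le_card:
  assumes "F \<subseteq> E"
    and "independent_domination_number V (E - F) \<noteq> independent_domination_number V E"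
  shows "independent_domination_bondage_number V E \<le> enat (card F)"
  unfolding independent_domination_bondage_number_def
  using assms by (intro Inf_lower) blast

lemma bondage_number_attained:
  assumes "independent_domination_bondage_number V E \<noteq> \<infinity>"
  obtains F where "F \<subseteq> E"
    and "independent_domination_number V (E - F) \<noteq> independent_domination_number V E"
    and "independent_domination_bondage_number V E = enat (card F)"
proof -
  let ?A = "{enat (card F) | F. F \<subseteq> E \<and>
    independent_domination_number V (E - F) \<noteq> independent_domination_number V E}"
  have "?A \<noteq> {}"
    using assms unfolding independent_domination_bondage_number_def
    by (metis (no_types, lifting) Inf_empty top_enat_def)
  \<comment> \<open>\<^typ>\<open>enat\<close> is well-ordered, so the infimum of a nonempty set belongs to it.\<close>
  then have "Inf ?A \<in> ?A"
    by (meson equals0I wellorder_InfI)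
  then show thesis
    using that unfolding independent_domination_bondage_number_def by blast
qed

theorem proposition3p1:
  fixes V :: "'a set" and E :: "'a set set" and e :: "'a set"
  assumes "finite_simple_graph V E" and "e \<in> E"
  shows "independent_domination_bondage_number V E
           \<le> independent_domination_bondage_number V (E - {e}) + 1"
proof (cases "independent_domination_number V (E - {e}) = independent_domination_number V E")
  case False
  then have "independent_domination_bondage_number V E \<le> enat (card {e})"
    using assms(2) by (intro bondage_number_le_card) auto
  also have "\<dots> = 1"
    by (simp add: one_enat_def)
  also have "\<dots> \<le> independent_domination_bondage_number V (E - {e}) + 1"
    by simp
  finally show ?thesis .
next
  case same: True
  show ?thesis
  proof (cases "independent_domination_bondage_number V (E - {e}) = \<infinity>")
    case True
    then show ?thesis by simp
  next
    case False
    then obtain F where F: "F \<subseteq> E - {e}"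
      and changes: "independent_domination_number V (E - {e} - F)
        \<noteq> independent_domination_number V (E - {e})"
      and optimal: "independent_domination_bondage_number V (E - {e}) = enat (card F)"
      by (rule bondage_number_attained)
    have "E \<subseteq> Pow V" and "finite V"
      using assms(1) by (auto simp: finite_simple_graph_def)
    then have "finite F"
      using F by (meson Diff_subset finite_Pow_iff finite_subset)
    have "E - insert e F = E - {e} - F" by blast
    then have "independent_domination_bondage_number V E \<le> enat (card (insert e F))"
      using F assms(2) changes same by (intro bondage_number_le_card) auto
    also have "card (insert e F) = card F + 1"
      using F \<open>finite F\<close> by (subst card_insert_disjoint) auto
    finally show ?thesis
      by (simp add: optimal one_enat_def)
  qed
qed

end
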